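(* Assume that $A_0^i$ and $A_{22}^i$ are Hurwitz for all $i\in\mathcal I$, and let $\gamma_{11}>1$. Then for all sequences $(t_k)_{k\ge0}$ of event times satisfying, for some $\tau^*>\frac{\ln(\gamma_{11})}{\lambda_s}$, the dwell-time property $\tau_k:=t_{k+1}-t_k\ge\tau^*$ for all $k\in\mathbb N$, and for all sequences $(\sigma_k)_{k\ge0}$ in $\mathcal I$ and $(\nu_k)_{k\ge1}$ in $\mathcal J$, the reduced order system $$\dot x(t)=A_0^{\sigma_k}x(t),\ t\in[t_k,t_{k+1}),\ k\in\mathbb N,\qquad x(t_k)=R_{11}^{\sigma_{k-1}\stackrel{\nu_k}{\to}\sigma_k}x(t_k^-),\ k\ge1,$$ with state $x(t)\in\mathbb R^{n_x}$, is globally asymptotically stable.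
   Context: Setting. Let $n_x,n_z\ge1$, $n=n_x+n_z$, let $\varepsilon>0$ be a parameter and $\mathcal I,\mathcal J$ finite nonempty index sets. For each $i\in\mathcal I$, $\mathbf D^i$ is an $n\times n$ diagonal matrix with $n_z$ diagonal entries equal to $\varepsilon$ and the other $n_x$ equal to $1$ (positions may depend on $i$), and $S_i$ is a permutation matrix with $S_i\mathbf D^iS_i^\top=\mathrm{diag}(I_{n_x},\varepsilon I_{n_z})$. Let $\mathbf A^i\in\mathbb R^{n\times n}$ ($i\in\mathcal I$) and $\mathbf J^j\in\mathbb R^{n\times n}$ ($j\in\mathcal J$) be given (independent of $\varepsilon$), and set $A^i=S_i\mathbf A^iS_i^\top$, $J^{i\stackrel{j}{\to}i'}=S_{i'}\mathbf J^jS_i^\top$ for $i,i'\in\mathcal I$, $j\in\mathcal J$. Write $A^i=\begin{pmatrix} A^i_{11} & A^i_{12} \\ A^i_{21} & A^i_{22} \end{pmatrix}$ and $J^{i\stackrel{j}{\to}i'}=\begin{pmatrix} J_{11}^{i\stackrel{j}{\to}i'} & J_{12}^{i\stackrel{j}{\to}i'} \\ J_{21}^{i\stackrel{j}{\to}i'} & J_{22}^{i\stackrel{j}{\to}i'} \end{pmatrix}$ in blocks of sizes $n_x,n_z$, with $A_{22}^i$ non-singular. Set $$A_0^i=A_{11}^i-A_{12}^i(A_{22}^i)^{-1}A_{21}^i,\qquad R_{11}^{i\stackrel{j}{\to}i'}=J_{11}^{i\stackrel{j}{\to}i'}-J_{12}^{i\stackrel{j}{\to}i'}(A_{22}^i)^{-1}A_{21}^i.$$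 A sequence of event times is a strictly increasing unbounded sequence $0=t_0<t_1<\cdots$; $x(t_k^-)$ denotes the left limit. Globally asymptotically stable means: the origin is Lyapunov stable (for every $\rho>0$ there is $\delta>0$ such that initial states at time $0$ of norm $<\delta$ give solutions of norm $<\rho$ for all $t\ge0$) and every solution tends to $0$ as $t\to\infty$. Constants. Since the $A_0^i$ are Hurwitz, fix symmetric matrices $Q_s^i\ge I_{n_x}$ and numbers $\lambda_s^i>0$ with $A_0^{i\top}Q_s^i+Q_s^iA_0^i\le-2\lambda_s^iQ_s^i$ for all $i\in\mathcal I$. Put $\lambda_s=\min_i\lambda_s^i$ and, with $\|\cdot\|$ the spectral norm, $$\gamma_{11}=\max_{i,i'\in\mathcal I,\,j\in\mathcal J}\|(Q_s^{i'})^{1/2}R_{11}^{i\stackrel{j}{\to}i'}(Q_s^i)^{-1/2}\|.$$ *)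

theory Defs
  imports "HOL-Analysis.Analysis"
begin

section \<open>Matrices\<close>

definition diag_matrix :: "('n \<Rightarrow> real) \<Rightarrow> real^'n^'n" where
  "diag_matrix d = (\<chi> i j. if i = j then d i else 0)"

definition permutation_matrix :: "real^'n^'n \<Rightarrow> bool" where
  "permutation_matrix S \<longleftrightarrow> (\<exists>p. bij p \<and> S = (\<chi> i j. if j = p i then 1 else 0))"

definition hurwitz :: "real^'n^'n \<Rightarrow> bool" where
  "hurwitz M \<longleftrightarrow>
     (\<forall>(z::complex) (v::complex^'n). v \<noteq> 0 \<and> map_matrix complex_of_real M *v v = z *s v \<longrightarrow> Re z < 0)"

definition psd :: "real^'n^'n \<Rightarrow> bool" where
  "psd M \<longleftrightarrow> transpose M = M \<and> (\<forall>v. 0 \<le> v \<bullet> (M *v v))"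

definition loewner_le :: "real^'n^'n \<Rightarrow> real^'n^'n \<Rightarrow> bool" where
  "loewner_le M N \<longleftrightarrow> psd (N - M)"

(* Only meaningful for psd Q, where the positive semidefinite square root exists and is unique. *)
definition psd_sqrt :: "real^'n^'n \<Rightarrow> real^'n^'n" where
  "psd_sqrt Q = (THE R. psd R \<and> R ** R = Q)"

(* The norm of the type real^'n^'m is the Frobenius norm, so the spectral norm has to be
   expressed as the operator norm induced by the Euclidean norms. *)
definition spectral_norm :: "real^'n^'m \<Rightarrow> real" where
  "spectral_norm M = onorm ((*v) M)"

text \<open>The indices of the state space of dimension \<open>n\<^sub>x + n\<^sub>z\<close> are the elements of the sum type
  \<open>'x + 'z\<close>, where \<open>n\<^sub>x = CARD('x)\<close> and \<open>n\<^sub>z = CARD('z)\<close>.\<close>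

definition block11 :: "real^('x::finite + 'z::finite)^('x + 'z) \<Rightarrow> real^'x^'x" where
  "block11 M = (\<chi> i j. M $ Inl i $ Inl j)"

definition block12 :: "real^('x::finite + 'z::finite)^('x + 'z) \<Rightarrow> real^'z^'x" where
  "block12 M = (\<chi> i j. M $ Inl i $ Inr j)"

definition block21 :: "real^('x::finite + 'z::finite)^('x + 'z) \<Rightarrow> real^'x^'z" where
  "block21 M = (\<chi> i j. M $ Inr i $ Inl j)"

definition block22 :: "real^('x::finite + 'z::finite)^('x + 'z) \<Rightarrow> real^'z^'z" where
  "block22 M = (\<chi> i j. M $ Inr i $ Inr j)"


section \<open>The singularly perturbed switched impulsive system\<close>

definition scale_matrix :: "real \<Rightarrow> real^('x::finite + 'z::finite)^('x + 'z) \<Rightarrow> bool" where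
  "scale_matrix \<epsilon> D \<longleftrightarrow>
     (\<exists>P :: ('x + 'z) set. card P = CARD('z) \<and> D = diag_matrix (\<lambda>a. if a \<in> P then \<epsilon> else 1))"

definition ordered_scale :: "real \<Rightarrow> real^('x::finite + 'z::finite)^('x + 'z)" where
  "ordered_scale \<epsilon> = diag_matrix (case_sum (\<lambda>_. 1) (\<lambda>_. \<epsilon>))"

(* In the next four definitions SS, AA and JJ are the families of the matrices S_i and of the bold
   matrices A^i and J^j; A_sys, J_sys, A_red and R_red are A^i, J^{i -j-> i'}, A_0^i and
   R_11^{i -j-> i'}, with i, j, i' in this order as the last arguments. *)

definition A_sys ::
    "('i \<Rightarrow> real^('x::finite + 'z::finite)^('x + 'z)) \<Rightarrow> ('i \<Rightarrow> real^('x + 'z)^('x + 'z))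
      \<Rightarrow> 'i \<Rightarrow> real^('x + 'z)^('x + 'z)" where
  "A_sys SS AA i = SS i ** AA i ** transpose (SS i)"

definition J_sys ::
    "('i \<Rightarrow> real^('x::finite + 'z::finite)^('x + 'z)) \<Rightarrow> ('j \<Rightarrow> real^('x + 'z)^('x + 'z))
      \<Rightarrow> 'i \<Rightarrow> 'j \<Rightarrow> 'i \<Rightarrow> real^('x + 'z)^('x + 'z)" where
  "J_sys SS JJ i j i' = SS i' ** JJ j ** transpose (SS i)"

definition A_red ::
    "('i \<Rightarrow> real^('x::finite + 'z::finite)^('x + 'z)) \<Rightarrow> ('i \<Rightarrow> real^('x + 'z)^('x + 'z)) \<Rightarrow> 'i \<Rightarrow> real^'x^'x" where
  "A_red SS AA i =
     block11 (A_sys SS AA i)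
       - block12 (A_sys SS AA i) ** matrix_inv (block22 (A_sys SS AA i)) ** block21 (A_sys SS AA i)"

definition R_red ::
    "('i \<Rightarrow> real^('x::finite + 'z::finite)^('x + 'z)) \<Rightarrow> ('i \<Rightarrow> real^('x + 'z)^('x + 'z))
      \<Rightarrow> ('j \<Rightarrow> real^('x + 'z)^('x + 'z)) \<Rightarrow> 'i \<Rightarrow> 'j \<Rightarrow> 'i \<Rightarrow> real^'x^'x" where
  "R_red SS AA JJ i j i' =
     block11 (J_sys SS JJ i j i')
       - block12 (J_sys SS JJ i j i') ** matrix_inv (block22 (A_sys SS AA i)) ** block21 (A_sys SS AA i)"

definition \<gamma>11 :: "('i::finite \<Rightarrow> real^'x^'x) \<Rightarrow> ('i \<Rightarrow> 'j::finite \<Rightarrow> 'i \<Rightarrow> real^'x^'x) \<Rightarrow> real" where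
  "\<gamma>11 Q R =
     (MAX (i, j, i') \<in> UNIV. spectral_norm (psd_sqrt (Q i') ** R i j i' ** matrix_inv (psd_sqrt (Q i))))"


section \<open>Solutions and stability\<close>

definition event_times :: "(nat \<Rightarrow> real) \<Rightarrow> bool" where
  "event_times t \<longleftrightarrow> t 0 = 0 \<and> strict_mono t \<and> \<not> bdd_above (range t)"

(* Solutions on the half-line from 0 to infinity; values at negative times are irrelevant.  At a time
   t k the derivative is one-sided, from the right.  The value \<nu> 0 is never used. *)
definition is_solution ::
    "('i \<Rightarrow> real^'x^'x) \<Rightarrow> ('i \<Rightarrow> 'j \<Rightarrow> 'i \<Rightarrow> real^'x^'x)
      \<Rightarrow> (nat \<Rightarrow> real) \<Rightarrow> (nat \<Rightarrow> 'i) \<Rightarrow> (nat \<Rightarrow> 'j) \<Rightarrow> (real \<Rightarrow> real^'x) \<Rightarrow> bool" where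
  "is_solution A R t \<sigma> \<nu> x \<longleftrightarrow>
     (\<forall>k. \<forall>s\<in>{t k..<t (Suc k)}.
        (x has_vector_derivative A (\<sigma> k) *v x s) (at s within {t k..<t (Suc k)})) \<and>
     (\<forall>k\<ge>1. \<exists>l. (x \<longlongrightarrow> l) (at_left (t k)) \<and> x (t k) = R (\<sigma> (k - 1)) (\<nu> k) (\<sigma> k) *v l)"

definition globally_asymptotically_stable ::
    "((real \<Rightarrow> 'a::real_normed_vector) \<Rightarrow> bool) \<Rightarrow> bool" where
  "globally_asymptotically_stable sol \<longleftrightarrow>
     (\<forall>\<rho>>0. \<exists>\<delta>>0. \<forall>x. sol x \<and> norm (x 0) < \<delta> \<longrightarrow> (\<forall>t\<ge>0. norm (x t) < \<rho>)) \<and>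
     (\<forall>x. sol x \<longrightarrow> (x \<longlongrightarrow> 0) at_top)"

end

theory Submission
  imports Defs
begin

text \<open>Each mode has the Lyapunov norm \<open>V\<^sub>i v = \<parallel>Q\<^sub>i\<^sup>1\<^sup>/\<^sup>2 v\<parallel>\<close>. It decays at least
  like \<open>exp (- \<lambda>\<^sub>s t)\<close> along the flow of mode \<open>i\<close> and grows at most by the factor \<open>\<gamma>\<^sub>1\<^sub>1\<close> across a
  jump, so from one event to the next it shrinks by \<open>q = \<gamma>\<^sub>1\<^sub>1 exp (- \<lambda>\<^sub>s \<tau>\<^sup>*) < 1\<close>.\<close>

section \<open>Self-adjoint maps and the square root\<close>

text \<open>First-order optimality at \<open>t = 0\<close>: the quadratic attains its minimum 0
  there, so its slope \<open>2 * a\<close> vanishes. This replaces differentiating the Rayleigh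
  quotient.\<close>

lemma nonneg_quadratic_linear_coeff_zero:
  fixes a b :: real
  assumes nonneg: "\<And>t. 0 \<le> 2 * t * a + t\<^sup>2 * b"
  shows "a = 0"
proof (rule ccontr)
  assume "a \<noteq> 0"
  \<comment> \<open>This \<open>t\<close> minimises the majorant with \<open>b\<close> replaced by
    \<open>\<bar>b\<bar> + 1\<close>; the 1 keeps the denominator positive when
    \<open>b = 0\<close>.\<close>
  define t where "t = - a / (\<bar>b\<bar> + 1)"
  have eq: "t * (\<bar>b\<bar> + 1) = - a"
    by (simp add: t_def)
  have "t \<noteq> 0"
    using \<open>a \<noteq> 0\<close> by (simp add: t_def)
  have "0 \<le> 2 * t * a + t\<^sup>2 * b"
    by (rule nonneg)
  also have "\<dots> \<le> 2 * t * a + t\<^sup>2 * (\<bar>b\<bar> + 1)"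
    by (intro add_left_mono mult_left_mono) auto
  also have "t\<^sup>2 * (\<bar>b\<bar> + 1) = - t * a"
    using eq by (simp add: power2_eq_square mult.assoc)
  also have "2 * t * a + - t * a = - (t\<^sup>2 * (\<bar>b\<bar> + 1))"
    using eq by (simp add: power2_eq_square mult.assoc)
  also have "\<dots> < 0"
    using \<open>t \<noteq> 0\<close> by (simp add: add_nonneg_pos)
  finally show False by simp
qed

text \<open>By compactness \<open>x \<bullet> f x\<close> attains its maximum on the unit sphere of
  \<open>S\<close>, and a maximiser is an eigenvector whose eigenvalue is the maximum.\<close>

lemma self_adjoint_invariant_subspace_eigenvector:
  fixes f :: "'a::euclidean_space \<Rightarrow> 'a"
  assumes lin: "linear f"
    and adj: "\<And>x y. f x \<bullet> y = x \<bullet> f y"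
    and S: "subspace S" "S \<noteq> {0}" and inv: "f ` S \<subseteq> S"
  obtains v c where "v \<in> S" "norm v = 1" "f v = c *\<^sub>R v"
proof -
  interpret linear f by fact
  have "0 \<in> S"
    using S by (simp add: subspace_0)
  with S obtain w where w: "w \<in> S" "w \<noteq> 0"
    by blast
  have "(1 / norm w) *\<^sub>R w \<in> S \<inter> sphere 0 1"
    using w S by (simp add: subspace_scale)
  then have ne: "S \<inter> sphere 0 1 \<noteq> {}"
    by blast
  have comp: "compact (S \<inter> sphere 0 1)"
    using closed_subspace[OF S(1)] by (simp add: closed_Int_compact)
  have cont: "continuous_on (S \<inter> sphere 0 1) (\<lambda>x. x \<bullet> f x)"
    by (intro continuous_intros linear_continuous_on linear_conv_bounded_linear[THEN iffD1] lin)
  obtain v where v: "v \<in> S" "norm v = 1"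
    and max: "\<And>y. y \<in> S \<Longrightarrow> norm y = 1 \<Longrightarrow> y \<bullet> f y \<le> v \<bullet> f v"
    using continuous_attains_sup[OF comp ne cont] by (auto simp: dist_norm)
  define c where "c = v \<bullet> f v"
  \<comment> \<open>Homogeneity carries the bound from the unit sphere to all of \<open>S\<close>,
    so perturbations of \<open>v\<close> need no renormalising.\<close>
  have max': "y \<bullet> f y \<le> c * (y \<bullet> y)" if "y \<in> S" for y
  proof (cases "y = 0")
    case False
    then have "((1 / norm y) *\<^sub>R y) \<bullet> f ((1 / norm y) *\<^sub>R y) \<le> c"
      unfolding c_def using that S by (intro max) (simp_all add: subspace_scale)
    then have "(y \<bullet> f y) / (norm y)\<^sup>2 \<le> c"
      by (simp add: scale power2_eq_square)
    then show ?thesis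
      using False by (simp add: power2_norm_eq_inner[symmetric] field_simps)
  qed (simp add: zero)
  have vv: "v \<bullet> v = 1"
    using v by (simp add: norm_eq_1)
  \<comment> \<open>The residual of the eigenvalue equation. It lies in \<open>S\<close> by
    invariance, so \<open>v\<close> may be perturbed along it; the slope of the resulting quadratic
    is then governed by \<open>u \<bullet> u\<close>.\<close>
  define u where "u = c *\<^sub>R v - f v"
  have uS: "u \<in> S"
    using S v inv by (auto simp: u_def intro!: subspace_diff subspace_scale)
  have "u \<bullet> u = 0"
  proof (rule nonneg_quadratic_linear_coeff_zero)
    fix t
    have "v + t *\<^sub>R u \<in> S"
      using S uS v by (simp add: subspace_add subspace_scale)
    from max'[OF this]
    have ineq: "v \<bullet> f v + t * (v \<bullet> f u) + t * (u \<bullet> f v) + t * t * (u \<bullet> f u) 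
       \<le> c * (v \<bullet> v + 2 * t * (u \<bullet> v) + t * t * (u \<bullet> u))"
      by (simp add: add scale inner_add_left inner_add_right algebra_simps inner_commute)
    have "v \<bullet> f u = u \<bullet> f v"
      by (metis adj inner_commute)
    moreover have "u \<bullet> u = c * (u \<bullet> v) - u \<bullet> f v"
      by (subst (2) u_def) (simp add: inner_diff_right)
    moreover have "0 \<le> 2 * t * (c * (u \<bullet> v) - u \<bullet> f v) + t\<^sup>2 * (c * (u \<bullet> u) - u \<bullet> f u)"
      if "v \<bullet> f u = u \<bullet> f v"
      using ineq that by (simp add: vv c_def[symmetric] algebra_simps power2_eq_square)
    ultimately show "0 \<le> 2 * t * (u \<bullet> u) + t\<^sup>2 * (c * (u \<bullet> u) - u \<bullet> f u)"
      by simp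
  qed
  then have "f v = c *\<^sub>R v"
    by (simp add: u_def)
  with v show ?thesis
    by (rule that)
qed

text \<open>Take an orthonormal set of eigenvectors of maximal cardinality. Its orthogonal
  complement is invariant under \<open>f\<close>, so if it were nontrivial it would contain one more
  eigenvector.\<close>

theorem self_adjoint_eigenbasis:
  fixes f :: "'a::euclidean_space \<Rightarrow> 'a"
  assumes lin: "linear f"
    and adj: "\<And>x y. f x \<bullet> y = x \<bullet> f y"
  obtains B where "finite B" "pairwise orthogonal B" "\<And>b. b \<in> B \<Longrightarrow> norm b = 1"
    "\<And>b. b \<in> B \<Longrightarrow> \<exists>c. f b = c *\<^sub>R b" "span B = UNIV"
proof -
  define P where "P B \<longleftrightarrow> pairwise orthogonal B \<and> (\<forall>b\<in>B. norm b = 1 \<and> (\<exists>c. f b = c *\<^sub>R b))" for B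
  \<comment> \<open>Unit vectors are nonzero, so orthogonality gives independence; the dimension
    bound then yields a set of maximal cardinality.\<close>
  have bound: "finite B \<and> card B \<le> DIM('a)" if "P B" for B
    using that by (intro independent_bound pairwise_orthogonal_independent) (auto simp: P_def)
  have "\<exists>B. P B \<and> (\<forall>C. P C \<longrightarrow> card C \<le> card B)"
    using ex_has_greatest_nat[of P "{}" card "Suc DIM('a)"] bound
    by (metis P_def empty_iff less_Suc_eq_le pairwise_empty)
  then obtain B where PB: "P B" and maxB: "\<And>C. P C \<Longrightarrow> card C \<le> card B"
    by blast
  have "span B = UNIV"
  proof (rule ccontr)
    assume "span B \<noteq> UNIV"
    then obtain a where a: "a \<noteq> 0" "\<And>x. x \<in> span B \<Longrightarrow> a \<bullet> x = 0"
      using span_not_UNIV_orthogonal by blast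
    define S where "S = {x. \<forall>b\<in>B. orthogonal b x}"
    have "subspace S"
      unfolding S_def subspace_def orthogonal_def by (simp add: inner_add_right)
    moreover have "S \<noteq> {0}"
      using a by (auto simp: S_def orthogonal_def inner_commute span_base)
    moreover have "f ` S \<subseteq> S"
    proof clarify
      fix x assume x: "x \<in> S"
      have "b \<bullet> f x = 0" if b: "b \<in> B" for b
      proof -
        obtain c where "f b = c *\<^sub>R b"
          using PB b by (auto simp: P_def)
        then show ?thesis
          using x b adj[of b x] by (simp add: S_def orthogonal_def)
      qed
      then show "f x \<in> S"
        by (simp add: S_def orthogonal_def)
    qed
    ultimately obtain v c where v: "v \<in> S" "norm v = 1" "f v = c *\<^sub>R v"
      using self_adjoint_invariant_subspace_eigenvector[OF lin adj] by metis
    have "v \<notin> B"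
      using v by (auto simp: S_def orthogonal_def norm_eq_1)
    moreover have "P (insert v B)"
      using PB v by (auto simp: P_def S_def orthogonal_commute intro!: pairwise_orthogonal_insert)
    ultimately show False
      using maxB[of "insert v B"] bound[OF PB] by simp
  qed
  with PB bound show ?thesis
    by (intro that[of B]) (auto simp: P_def)
qed

section \<open>Existence and uniqueness of positive semidefinite square roots\<close>

lemma matrix_symmetric_iff_self_adjoint:
  fixes M :: "real^'n^'n"
  shows "transpose M = M \<longleftrightarrow> (\<forall>x y. (M *v x) \<bullet> y = x \<bullet> (M *v y))"
proof
  assume "transpose M = M"
  then show "\<forall>x y. (M *v x) \<bullet> y = x \<bullet> (M *v y)"
    by (metis dot_lmul_matrix transpose_matrix_vector)
next
  assume *: "\<forall>x y. (M *v x) \<bullet> y = x \<bullet> (M *v y)"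
  have "adjoint ((*v) M) = (*v) M"
    using * by (intro adjoint_unique) simp
  then have "(*v) (transpose M) = (*v) M"
    using adjoint_matrix[of M] by metis
  then show "transpose M = M"
    by (metis matrix_eq)
qed

lemma psd_symmetric: "psd M \<Longrightarrow> (M *v x) \<bullet> y = x \<bullet> (M *v y)"
  using matrix_symmetric_iff_self_adjoint by (auto simp: psd_def)

text \<open>The root acts on an orthonormal eigenbasis of \<open>Q\<close> by the square roots of
  the eigenvalues.\<close>

lemma psd_sqrt_exists:
  fixes Q :: "real^'n^'n"
  assumes "psd Q"
  obtains R where "psd R" "R ** R = Q"
proof -
  obtain B where B: "finite B" "pairwise orthogonal B" "\<And>b. b \<in> B \<Longrightarrow> norm b = 1"
    "\<And>b. b \<in> B \<Longrightarrow> \<exists>c. Q *v b = c *\<^sub>R b" "span B = UNIV"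
    using self_adjoint_eigenbasis[of "(*v) Q"] psd_symmetric[OF assms] matrix_vector_mul_linear
    by metis
  \<comment> \<open>On a unit eigenvector this is the eigenvalue. As a value of the quadratic form
    it is nonnegative at once, and no choice of eigenvalues is needed.\<close>
  define c where "c b = b \<bullet> (Q *v b)" for b
  have nonneg: "0 \<le> c b" for b
    using assms by (simp add: c_def psd_def)
  have eig: "Q *v b = c b *\<^sub>R b" if "b \<in> B" for b
    using B(3,4)[OF that] by (auto simp: c_def norm_eq_1)
  define g where "g x = (\<Sum>b\<in>B. (sqrt (c b) * (b \<bullet> x)) *\<^sub>R b)" for x
  have lin: "linear g"
    unfolding g_def
    by (rule linearI)
      (simp_all add: inner_add_right algebra_simps sum.distrib scaleR_sum_right)
  define R where "R = matrix g"
  have Rg: "R *v x = g x" for x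
    by (simp add: R_def lin matrix_works)
  have g_eig: "g b = sqrt (c b) *\<^sub>R b" if "b \<in> B" for b
  proof -
    have "g b = (\<Sum>b'\<in>B. if b' = b then sqrt (c b) *\<^sub>R b else 0)"
      unfolding g_def using B(2,3) that
      by (intro sum.cong refl) (auto simp: pairwise_def orthogonal_def norm_eq_1)
    then show ?thesis
      using B(1) that by simp
  qed
  have "psd R"
    unfolding psd_def
  proof (intro conjI allI)
    show "transpose R = R"
      unfolding matrix_symmetric_iff_self_adjoint Rg g_def
      by (simp add: inner_sum_left inner_sum_right ac_simps inner_commute)
    show "0 \<le> v \<bullet> (R *v v)" for v
      unfolding Rg g_def inner_sum_right
      by (intro sum_nonneg) (simp add: nonneg inner_commute mult.assoc)
  qed
  moreover have "R ** R = Q"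
  proof -
    have "(R ** R) *v b = Q *v b" if "b \<in> B" for b
      using that nonneg[of b]
      by (simp add: Rg g_eig eig linear_scale[OF lin] matrix_vector_mul_assoc[symmetric])
    then have "(R ** R) *v x = Q *v x" for x
      using linear_eq_on_span[of "(*v) (R ** R)" "(*v) Q" B x] B(5) by simp
    then show ?thesis
      by (simp add: matrix_eq)
  qed
  ultimately show ?thesis
    by (rule that)
qed

text \<open>If \<open>D = R - S\<close>, then \<open>R D + D S = 0\<close>; testing this against an eigenvector
  of \<open>D\<close> shows that the eigenvalue vanishes.\<close>

lemma psd_sqrt_unique:
  fixes R S :: "real^'n^'n"
  assumes R: "psd R" and S: "psd S" and eq: "R ** R = S ** S"
  shows "R = S"
proof -
  define D where "D = R - S"
  have D: "D *v x = R *v x - S *v x" for x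
    by (simp add: D_def matrix_vector_mult_diff_rdistrib)
  have adj: "(D *v x) \<bullet> y = x \<bullet> (D *v y)" for x y
    by (simp add: D inner_diff_left inner_diff_right psd_symmetric[OF R] psd_symmetric[OF S])
  obtain B where B: "\<And>b. b \<in> B \<Longrightarrow> norm b = 1"
    "\<And>b. b \<in> B \<Longrightarrow> \<exists>c. D *v b = c *\<^sub>R b" "span B = UNIV"
    using self_adjoint_eigenbasis[of "(*v) D"] adj matrix_vector_mul_linear by metis
  have "D *v b = 0" if b: "b \<in> B" for b
  proof -
    obtain c where c: "D *v b = c *\<^sub>R b"
      using B(2) b by blast
    have bb: "b \<bullet> b = 1"
      using B(1)[OF b] by (simp add: norm_eq_1)
    have "R *v (R *v b) = S *v (S *v b)"
      using eq by (simp add: matrix_vector_mul_assoc)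
    then have "R *v (D *v b) + D *v (S *v b) = 0"
      by (simp add: D matrix_vector_mult_diff_distrib)
    then have "b \<bullet> (R *v (D *v b)) + b \<bullet> (D *v (S *v b)) = 0"
      by (metis inner_add_right inner_zero_right)
    then have sum0: "c * (b \<bullet> (R *v b) + b \<bullet> (S *v b)) = 0"
      using adj[of b "S *v b"] by (simp add: c algebra_simps)
    moreover have "0 \<le> b \<bullet> (R *v b)" "0 \<le> b \<bullet> (S *v b)"
      using R S by (auto simp: psd_def)
    \<comment> \<open>If \<open>c\<close> were nonzero, \<open>sum0\<close> would force both
      nonnegative terms to be 0, and so their difference \<open>c\<close> as well.\<close>
    moreover have "c = b \<bullet> (R *v b) - b \<bullet> (S *v b)"
      using c bb by (metis D inner_diff_right inner_scaleR_right mult.right_neutral)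
    ultimately have "c = 0"
      by (auto simp: add_nonneg_eq_0_iff)
    then show ?thesis
      by (simp add: c)
  qed
  then have "D *v x = 0" for x
    using linear_eq_0_on_span[of "(*v) D" B x] B(3) by simp
  then show ?thesis
    by (simp add: D matrix_eq)
qed

text \<open>Existence and uniqueness make the definite description in \<open>psd_sqrt\<close>
  meaningful.\<close>

lemma psd_sqrt:
  assumes "psd Q"
  shows "psd (psd_sqrt Q)" and "psd_sqrt Q ** psd_sqrt Q = Q"
proof -
  have "\<exists>!R. psd R \<and> R ** R = Q"
    using psd_sqrt_exists[OF assms] psd_sqrt_unique by metis
  from theI'[OF this] show "psd (psd_sqrt Q)" and "psd_sqrt Q ** psd_sqrt Q = Q"
    by (simp_all add: psd_sqrt_def)
qed

text \<open>Links the two forms of the Lyapunov function: the norm, suited to jumps, and the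
  quadratic form, which can be differentiated along the flow.\<close>

lemma norm_psd_sqrt:
  assumes "psd Q"
  shows "(norm (psd_sqrt Q *v x))\<^sup>2 = x \<bullet> (Q *v x)"
  using psd_symmetric[OF psd_sqrt(1)[OF assms], of x "psd_sqrt Q *v x"] psd_sqrt(2)[OF assms]
  by (simp add: power2_norm_eq_inner matrix_vector_mul_assoc)

section \<open>Decay along flows and jumps\<close>

lemma psd_if_ge_mat_1:
  assumes sym: "transpose Q = Q" and ge: "loewner_le (mat 1) Q"
  shows "psd Q" and "norm v \<le> norm (psd_sqrt Q *v v)"
proof -
  have ge': "v \<bullet> v \<le> v \<bullet> (Q *v v)" for v
    using ge by (auto simp: loewner_le_def psd_def matrix_vector_mult_diff_rdistrib inner_diff_right)
  show "psd Q"
    unfolding psd_def using sym ge' by (meson inner_ge_zero order_trans)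
  from norm_psd_sqrt[OF this] ge' have "(norm v)\<^sup>2 \<le> (norm (psd_sqrt Q *v v))\<^sup>2"
    by (simp add: power2_norm_eq_inner)
  then show "norm v \<le> norm (psd_sqrt Q *v v)"
    by (rule power2_le_imp_le) simp
qed

text \<open>The bound makes the kernel trivial, and an injective square matrix is invertible. It is
  applied to the roots of the \<open>Q i\<close>.\<close>

lemma invertible_if_norm_le:
  fixes P :: "real^'n^'n"
  assumes "\<And>v. norm v \<le> norm (P *v v)"
  shows "invertible P"
proof -
  have "inj ((*v) P)"
    using assms[of "x - y" for x y]
    by (intro injI) (metis eq_iff_diff_eq_0 matrix_vector_mult_diff_distrib norm_le_zero_iff norm_zero)
  then show ?thesis
    by (simp add: invertible_left_inverse matrix_left_invertible_injective)
qed

lemma matrix_inv_mult_left: "invertible A \<Longrightarrow> matrix_inv A ** A = mat 1"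
  unfolding invertible_def matrix_inv_def by (metis (mono_tags, lifting) someI_ex)

lemma norm_le_spectral_norm: "norm (M *v v) \<le> spectral_norm M * norm v"
  unfolding spectral_norm_def by (rule onorm) simp

text \<open>Inserting the inverse of the root of \<open>Q i\<close> followed by the root itself in
  front of \<open>v\<close> produces the matrix whose spectral norm enters the maximum.\<close>

lemma \<gamma>11_bound:
  assumes "\<And>i. invertible (psd_sqrt (Q i))"
  shows "norm (psd_sqrt (Q i') *v (R i j i' *v v)) \<le> \<gamma>11 Q R * norm (psd_sqrt (Q i) *v v)"
proof -
  let ?M = "psd_sqrt (Q i') ** R i j i' ** matrix_inv (psd_sqrt (Q i))"
  have "matrix_inv (psd_sqrt (Q i)) *v (psd_sqrt (Q i) *v v) = v"
    by (simp add: matrix_vector_mul_assoc assms matrix_inv_mult_left)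
  then have "psd_sqrt (Q i') *v (R i j i' *v v) = ?M *v (psd_sqrt (Q i) *v v)"
    by (simp add: matrix_vector_mul_assoc[symmetric])
  also have "norm \<dots> \<le> spectral_norm ?M * norm (psd_sqrt (Q i) *v v)"
    by (rule norm_le_spectral_norm)
  also have "spectral_norm ?M \<le> \<gamma>11 Q R"
    unfolding \<gamma>11_def by (rule Max_ge) (auto intro!: image_eqI[where x = "(i, j, i')"])
  finally show ?thesis
    by (simp add: mult_right_mono)
qed

section \<open>Decay along the flow of one mode\<close>

text \<open>The Lyapunov inequality says that the squared norm \<open>W\<close> decays at rate
  \<open>2 * l\<close>, so \<open>W\<close> weighted by \<open>exp (2 * l * (u - a))\<close> does
  not increase. Taking square roots halves the rate.\<close>

lemma lyapunov_flow_decay: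
  fixes x :: "real \<Rightarrow> real^'n"
  assumes deriv: "\<And>s. s \<in> {a..<b} \<Longrightarrow> (x has_vector_derivative A *v x s) (at s within {a..<b})"
    and Q: "psd Q"
    and lyap: "loewner_le (transpose A ** Q + Q ** A) ((- 2 * l) *\<^sub>R Q)"
    and s: "s \<in> {a..<b}"
  shows "norm (psd_sqrt Q *v x s) \<le> exp (- l * (s - a)) * norm (psd_sqrt Q *v x a)"
proof (cases "s = a")
  case False
  with s have "a < s"
    by simp
  define W where "W u = x u \<bullet> (Q *v x u)" for u
  define g where "g u = exp (2 * l * (u - a)) * W u" for u
  \<comment> \<open>The solution is differentiable only within the half-open interval, while the
    mean value theorem needs a closed one; \<open>s < b\<close> allows the restriction.\<close>
  have sub: "{a..s} \<subseteq> {a..<b}"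
    using s by auto
  have dW: "(W has_real_derivative 2 * ((A *v x u) \<bullet> (Q *v x u))) (at u within {a..s})"
    if "u \<in> {a..s}" for u
  proof -
    have d: "(x has_vector_derivative A *v x u) (at u within {a..s})"
      using deriv[of u] sub that by (blast intro: has_vector_derivative_within_subset)
    have "(W has_vector_derivative x u \<bullet> (Q *v (A *v x u)) + (A *v x u) \<bullet> (Q *v x u)) (at u within {a..s})"
      unfolding W_def
      by (rule bounded_bilinear.has_vector_derivative[OF bounded_bilinear_inner d
            bounded_linear.has_vector_derivative[OF matrix_vector_mul_bounded_linear d]])
    moreover have "x u \<bullet> (Q *v (A *v x u)) = (A *v x u) \<bullet> (Q *v x u)"
      by (metis Q inner_commute psd_symmetric)
    ultimately show ?thesis
      by (simp add: has_real_derivative_iff_has_vector_derivative)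
  qed
  have dissip: "2 * ((A *v x u) \<bullet> (Q *v x u)) \<le> - 2 * l * W u" for u
  proof -
    have "0 \<le> x u \<bullet> (((- 2 * l) *\<^sub>R Q - (transpose A ** Q + Q ** A)) *v x u)"
      using lyap by (simp add: loewner_le_def psd_def)
    also have "\<dots> = - 2 * l * W u
        - (x u \<bullet> (transpose A *v (Q *v x u)) + x u \<bullet> (Q *v (A *v x u)))"
      by (simp add: matrix_vector_mult_diff_rdistrib matrix_vector_mult_add_rdistrib inner_diff_right
          inner_add_right scaleR_matrix_vector_assoc[symmetric] matrix_vector_mul_assoc[symmetric]
          W_def del: transpose_matrix_vector scaleR_minus_left)
    also have "x u \<bullet> (transpose A *v (Q *v x u)) = (A *v x u) \<bullet> (Q *v x u)"
      by (metis dot_lmul_matrix inner_commute transpose_matrix_vector)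
    also have "x u \<bullet> (Q *v (A *v x u)) = (A *v x u) \<bullet> (Q *v x u)"
      by (metis Q inner_commute psd_symmetric)
    finally show ?thesis
      by simp
  qed
  have dg: "(g has_real_derivative
      exp (2 * l * (u - a)) * (2 * l * W u + 2 * ((A *v x u) \<bullet> (Q *v x u)))) (at u within {a..s})"
    if "u \<in> {a..s}" for u
    unfolding g_def
    by (rule derivative_eq_intros dW[OF that] refl)+ (simp add: algebra_simps)
  obtain u where "g s - g a
      = exp (2 * l * (u - a)) * (2 * l * W u + 2 * ((A *v x u) \<bullet> (Q *v x u))) * (s - a)"
    using mvt_simple[OF \<open>a < s\<close>, of g
        "\<lambda>u. (*) (exp (2 * l * (u - a)) * (2 * l * W u + 2 * ((A *v x u) \<bullet> (Q *v x u))))"]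
      dg by (auto simp: has_field_derivative_def)
  moreover have "\<dots> \<le> 0"
    using dissip[of u] \<open>a < s\<close> by (simp add: mult_le_0_iff)
  ultimately have "exp (2 * l * (s - a)) * W s \<le> W a"
    by (simp add: g_def)
  then have "exp (- 2 * l * (s - a)) * (exp (2 * l * (s - a)) * W s) \<le> exp (- 2 * l * (s - a)) * W a"
    by (rule mult_left_mono) simp
  then have "W s \<le> exp (- 2 * l * (s - a)) * W a"
    by (simp add: mult.assoc[symmetric] exp_add[symmetric])
  also have "exp (- 2 * l * (s - a)) = (exp (- l * (s - a)))\<^sup>2"
    by (simp add: power2_eq_square exp_add[symmetric])
  finally have "(norm (psd_sqrt Q *v x s))\<^sup>2 \<le> (exp (- l * (s - a)) * norm (psd_sqrt Q *v x a))\<^sup>2"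
    by (simp add: W_def norm_psd_sqrt[OF Q] power_mult_distrib)
  then show ?thesis
    by (rule power2_le_imp_le) simp
qed simp

section \<open>Stability of the switched system\<close>

text \<open>Unboundedness gives an event after \<open>s\<close>. The least such index is positive
  because \<open>t 0 = 0\<close>, and its predecessor is the wanted \<open>k\<close>.\<close>

lemma event_times_interval:
  assumes "event_times t" and "0 \<le> s"
  obtains k where "s \<in> {t k..<t (Suc k)}"
proof -
  have "\<exists>k. s < t k"
    using assms(1) unfolding event_times_def bdd_above_def by (metis linorder_not_le rangeE)
  define m where "m = (LEAST k. s < t k)"
  have m: "s < t m"
    unfolding m_def using \<open>\<exists>k. s < t k\<close> by (rule LeastI_ex)
  then obtain k where k: "m = Suc k"
    using assms by (cases m) (auto simp: event_times_def)
  then have "t k \<le> s"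
    using not_less_Least[of k "\<lambda>k. s < t k"] by (simp add: m_def[symmetric])
  with m k show ?thesis
    by (intro that[of k]) simp
qed

text \<open>Abstracts from the block structure and from the origin of \<gamma>: only the flow
  inequality, the jump estimate and the contraction condition enter.\<close>

theorem dwell_time_stability:
  fixes A :: "'i::finite \<Rightarrow> real^'x^'x" and R :: "'i \<Rightarrow> 'j \<Rightarrow> 'i \<Rightarrow> real^'x^'x"
  assumes t: "event_times t"
    and dwell: "\<And>k. \<tau> \<le> t (Suc k) - t k"
    and Q: "\<And>i. psd (Q i)"
    and lower: "\<And>i v. norm v \<le> norm (psd_sqrt (Q i) *v v)"
    and lyap: "\<And>i. loewner_le (transpose (A i) ** Q i + Q i ** A i) ((- 2 * lam i) *\<^sub>R Q i)"
    and lam: "0 \<le> l" "\<And>i. l \<le> lam i"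
    and jump: "\<And>i j i' v. norm (psd_sqrt (Q i') *v (R i j i' *v v)) \<le> \<gamma> * norm (psd_sqrt (Q i) *v v)"
    and \<gamma>: "0 \<le> \<gamma>" "\<gamma> * exp (- l * \<tau>) < 1"
  shows "globally_asymptotically_stable (is_solution A R t \<sigma> \<nu>)"
proof -
  define q where "q = \<gamma> * exp (- l * \<tau>)"
  have q: "0 \<le> q" "q < 1"
    using \<gamma> by (simp_all add: q_def)
  define V where "V i v = norm (psd_sqrt (Q i) *v v)" for i v
  \<comment> \<open>A common upper bound for finitely many modes; with \<open>lower\<close> it makes
    all the norms \<open>V i\<close> uniformly equivalent to the Euclidean norm.\<close>
  define C where "C = Max (range (\<lambda>i. spectral_norm (psd_sqrt (Q i))))"
  have VC: "V i v \<le> C * norm v" for i v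
  proof -
    have "spectral_norm (psd_sqrt (Q i)) \<le> C"
      unfolding C_def by (rule Max_ge) auto
    then show ?thesis
      unfolding V_def by (meson norm_le_spectral_norm order_trans mult_right_mono norm_ge_zero)
  qed
  have t0: "t 0 = 0" and tmono: "strict_mono t"
    using t by (simp_all add: event_times_def)
  \<comment> \<open>Holding for every \<open>s\<close> after \<open>t k\<close>, this serves both
    claims: \<open>k = 0\<close> gives Lyapunov stability, and large \<open>k\<close> gives
    convergence.\<close>
  have bound: "norm (x s) \<le> q ^ k * (C * norm (x 0))"
    if sol: "is_solution A R t \<sigma> \<nu> x" and s: "t k \<le> s" for x s k
  proof -
    have flow: "V (\<sigma> k) (x u) \<le> exp (- l * (u - t k)) * V (\<sigma> k) (x (t k))"
      if "u \<in> {t k..<t (Suc k)}" for k u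
    proof -
      have "V (\<sigma> k) (x u) \<le> exp (- lam (\<sigma> k) * (u - t k)) * V (\<sigma> k) (x (t k))"
        unfolding V_def using sol
        by (intro lyapunov_flow_decay[OF _ Q lyap that]) (auto simp: is_solution_def)
      also have "\<dots> \<le> exp (- l * (u - t k)) * V (\<sigma> k) (x (t k))"
        using lam(2) that by (intro mult_right_mono) (auto simp: V_def intro!: mult_right_mono)
      finally show ?thesis .
    qed
    have step: "V (\<sigma> (Suc k)) (x (t (Suc k))) \<le> q * V (\<sigma> k) (x (t k))" for k
    proof -
      have lt: "t k < t (Suc k)"
        using tmono by (simp add: strict_mono_less)
      from sol obtain y where y: "(x \<longlongrightarrow> y) (at_left (t (Suc k)))"
        "x (t (Suc k)) = R (\<sigma> k) (\<nu> (Suc k)) (\<sigma> (Suc k)) *v y"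
        unfolding is_solution_def by (metis One_nat_def Suc_le_mono diff_Suc_1 le0)
      \<comment> \<open>The flow estimate stops short of \<open>t (Suc k)\<close>; by continuity of
        the norm it passes to the left limit \<open>y\<close>, to which the jump is applied.\<close>
      have "V (\<sigma> k) y \<le> exp (- l * (t (Suc k) - t k)) * V (\<sigma> k) (x (t k))"
      proof (rule tendsto_le)
        show "((\<lambda>u. V (\<sigma> k) (x u)) \<longlongrightarrow> V (\<sigma> k) y) (at_left (t (Suc k)))"
          unfolding V_def
          by (intro tendsto_norm bounded_linear.tendsto[OF matrix_vector_mul_bounded_linear] y(1))
        show "((\<lambda>u. exp (- l * (u - t k)) * V (\<sigma> k) (x (t k))) \<longlongrightarrow>
            exp (- l * (t (Suc k) - t k)) * V (\<sigma> k) (x (t k))) (at_left (t (Suc k)))"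
          by (intro tendsto_intros)
        show "\<forall>\<^sub>F u in at_left (t (Suc k)).
            V (\<sigma> k) (x u) \<le> exp (- l * (u - t k)) * V (\<sigma> k) (x (t k))"
          unfolding eventually_at_left[OF lt] using lt flow by (intro exI[of _ "t k"]) auto
      qed simp
      \<comment> \<open>The dwell time enters here: a longer stay in a mode only strengthens the
        decay, as \<open>l\<close> is nonnegative.\<close>
      also have "\<dots> \<le> exp (- l * \<tau>) * V (\<sigma> k) (x (t k))"
        using dwell[of k] lam(1) by (intro mult_right_mono) (auto simp: V_def intro!: mult_left_mono)
      finally have "\<gamma> * V (\<sigma> k) y \<le> q * V (\<sigma> k) (x (t k))"
        using \<gamma>(1) by (simp add: q_def mult.assoc mult_left_mono)
      moreover have "V (\<sigma> (Suc k)) (x (t (Suc k))) \<le> \<gamma> * V (\<sigma> k) y"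
        unfolding V_def y(2) by (rule jump)
      ultimately show ?thesis
        by linarith
    qed
    have events: "V (\<sigma> k) (x (t k)) \<le> q ^ k * (C * norm (x 0))" for k
    proof (induction k)
      case 0
      show ?case
        using VC by (simp add: t0)
    next
      case (Suc k)
      have "q * V (\<sigma> k) (x (t k)) \<le> q * (q ^ k * (C * norm (x 0)))"
        using Suc q by (intro mult_left_mono)
      with step[of k] show ?case
        by (simp add: mult.assoc)
    qed
    have "0 \<le> s"
      using s tmono t0 by (metis le0 order_trans strict_mono_less_eq)
    then obtain m where m: "s \<in> {t m..<t (Suc m)}"
      using event_times_interval[OF t] by metis
    then have "t k < t (Suc m)"
      using s by simp
    \<comment> \<open>Several events may lie between \<open>t k\<close> and \<open>s\<close>; since
      \<open>q < 1\<close>, the extra factors only help.\<close>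
    then have "k \<le> m"
      using tmono by (simp add: strict_mono_less)
    have "norm (x s) \<le> V (\<sigma> m) (x s)"
      by (simp add: V_def lower)
    also have "\<dots> \<le> exp (- l * (s - t m)) * V (\<sigma> m) (x (t m))"
      by (rule flow[OF m])
    also have "\<dots> \<le> 1 * V (\<sigma> m) (x (t m))"
      using m lam(1) by (intro mult_right_mono) (auto simp: V_def)
    also have "\<dots> \<le> q ^ m * (C * norm (x 0))"
      using events by simp
    also have "\<dots> \<le> q ^ k * (C * norm (x 0))"
    proof (rule mult_right_mono)
      show "q ^ m \<le> q ^ k"
        using q \<open>k \<le> m\<close> by (simp add: power_decreasing)
      show "0 \<le> C * norm (x 0)"
        \<comment> \<open>Any mode will do: \<open>undefined\<close> is just some element of the
          nonempty index type.\<close>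
        using VC[of undefined "x 0"] by (metis V_def norm_ge_zero order_trans)
    qed
    finally show ?thesis .
  qed
  show ?thesis
    unfolding globally_asymptotically_stable_def
  proof (intro conjI allI impI)
    fix \<rho> :: real
    assume "\<rho> > 0"
    \<comment> \<open>The denominator exceeds \<open>C\<close> and is positive whatever the value of
      \<open>C\<close>.\<close>
    define \<delta> where "\<delta> = \<rho> / (\<bar>C\<bar> + 1)"
    have "norm (x s) < \<rho>" if "is_solution A R t \<sigma> \<nu> x" "norm (x 0) < \<delta>" "0 \<le> s" for x s
    proof -
      have "norm (x s) \<le> C * norm (x 0)"
        using bound[OF that(1), of 0 s] that(3) t0 by simp
      also have "\<dots> \<le> (\<bar>C\<bar> + 1) * norm (x 0)"
        by (intro mult_right_mono) auto
      also have "\<dots> < \<rho>"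
        using that(2) by (simp add: \<delta>_def field_simps add_pos_nonneg)
      finally show ?thesis .
    qed
    moreover have "\<delta> > 0"
      using \<open>\<rho> > 0\<close> by (simp add: \<delta>_def add_nonneg_pos)
    ultimately show "\<exists>\<delta>>0. \<forall>x. is_solution A R t \<sigma> \<nu> x \<and> norm (x 0) < \<delta> \<longrightarrow> (\<forall>t\<ge>0. norm (x t) < \<rho>)"
      by blast
  next
    fix x
    assume sol: "is_solution A R t \<sigma> \<nu> x"
    show "(x \<longlongrightarrow> 0) at_top"
    proof (rule tendstoI)
      fix e :: real
      assume "e > 0"
      have "(\<lambda>k. q ^ k * (C * norm (x 0))) \<longlonglongrightarrow> 0"
        using q by (intro tendsto_mult_left_zero LIMSEQ_realpow_zero) auto
      from order_tendstoD(2)[OF this \<open>e > 0\<close>]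
      obtain k where "q ^ k * (C * norm (x 0)) < e"
        by (auto simp: eventually_sequentially)
      with bound[OF sol] have "dist (x s) 0 < e" if "t k \<le> s" for s
        using that by (metis dist_0_norm dist_commute le_less_trans)
      then show "\<forall>\<^sub>F s in at_top. dist (x s) 0 < e"
        by (auto simp: eventually_at_top_linorder)
    qed
  qed
qed

theorem proposition13:
  fixes \<epsilon> :: real
    and DD SS AA :: "'i::finite \<Rightarrow> real^('x::finite + 'z::finite)^('x + 'z)"
    and JJ :: "'j::finite \<Rightarrow> real^('x + 'z)^('x + 'z)"
    and Q :: "'i \<Rightarrow> real^'x^'x"
    and lam :: "'i \<Rightarrow> real"
  assumes "\<epsilon> > 0"
    and "\<And>i. scale_matrix \<epsilon> (DD i)"
    and "\<And>i. permutation_matrix (SS i)"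
    and "\<And>i. SS i ** DD i ** transpose (SS i) = ordered_scale \<epsilon>"
    and "\<And>i. invertible (block22 (A_sys SS AA i))"
    and "\<And>i. hurwitz (A_red SS AA i)"
    and "\<And>i. hurwitz (block22 (A_sys SS AA i))"
    and "\<And>i. transpose (Q i) = Q i"
    and "\<And>i. loewner_le (mat 1) (Q i)"
    and "\<And>i. lam i > 0"
    and "\<And>i. loewner_le (transpose (A_red SS AA i) ** Q i + Q i ** A_red SS AA i)
                         ((- 2 * lam i) *\<^sub>R Q i)"
    and "\<gamma>11 Q (R_red SS AA JJ) > 1"
  shows "\<forall>t. event_times t \<and>
             (\<exists>\<tau>>ln (\<gamma>11 Q (R_red SS AA JJ)) / Min (range lam). \<forall>k. t (Suc k) - t k \<ge> \<tau>) \<longrightarrow>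
           (\<forall>\<sigma> \<nu>. globally_asymptotically_stable
                    (is_solution (A_red SS AA) (R_red SS AA JJ) t \<sigma> \<nu>))"
proof (intro allI impI)
  fix t \<sigma> \<nu>
  let ?A = "A_red SS AA" and ?R = "R_red SS AA JJ"
  define \<gamma> where "\<gamma> = \<gamma>11 Q ?R"
  define l where "l = Min (range lam)"
  assume "event_times t \<and> (\<exists>\<tau>>ln (\<gamma>11 Q ?R) / Min (range lam). \<forall>k. t (Suc k) - t k \<ge> \<tau>)"
  then obtain \<tau> where t: "event_times t" and \<tau>: "ln \<gamma> / l < \<tau>" "\<And>k. \<tau> \<le> t (Suc k) - t k"
    by (auto simp: \<gamma>_def l_def)
  have \<gamma>: "\<gamma> > 1"
    using assms(12) by (simp add: \<gamma>_def)
  have l_le: "l \<le> lam i" for i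
    by (simp add: l_def)
  have l: "l > 0"
    using assms(10) by (simp add: l_def)
  note Q = psd_if_ge_mat_1[OF assms(8,9)]
  \<comment> \<open>The dwell-time threshold rearranged: \<open>ln \<gamma> < l * \<tau>\<close>
    means that the decay over one dwell period outweighs the growth at a jump.\<close>
  have contr: "\<gamma> * exp (- l * \<tau>) < 1"
  proof -
    have "ln \<gamma> < l * \<tau>"
      using \<tau>(1) l by (simp add: field_simps)
    then have "exp (ln \<gamma>) < exp (l * \<tau>)"
      by (rule exp_less_mono)
    then show ?thesis
      using \<gamma> by (simp add: exp_minus field_simps)
  qed
  have jump: "norm (psd_sqrt (Q i') *v (?R i j i' *v v)) \<le> \<gamma> * norm (psd_sqrt (Q i) *v v)"
    for i j i' v
    unfolding \<gamma>_def by (rule \<gamma>11_bound) (rule invertible_if_norm_le[OF Q(2)])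
  show "globally_asymptotically_stable (is_solution ?A ?R t \<sigma> \<nu>)"
    \<comment> \<open>\<open>Q\<close> stands for two facts, which discharge positive
      semidefiniteness and the lower norm bound; the placeholder leaves
      \<open>0 \<le> \<gamma>\<close>.\<close>
    by (rule dwell_time_stability[OF t \<tau>(2) Q assms(11) less_imp_le[OF l] l_le jump _ contr])
      (use \<gamma> in simp)
qed

end
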